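(* Let $r$ be an odd positive integer and $q$ a positive integer. Let $g(a)=\frac{\pi}{4}\cdot\frac{1+\tan(\frac\pi4a)}{1-\tan(\frac\pi4a)}$ for $a\in(-1,1)$, and let $\Delta_r=\sum_{n=1}^\infty\frac{(-1)^{n-1}}{n^r}$. Then $$\sum_{m=0}^\infty(-1)^m\left(\sum_{l=mq+1}^{(m+1)q}\frac{1}{l^r}\right)=\frac{\Delta_r}{q^r}+\frac{2^r}{(r-1)!\,q^r}\sum_{k=1}^{q-1}g^{(r-1)}\Big(\frac{q-2k}{q}\Big),$$ where for $q=1$ the sum over $k$ on the right is empty and equal to $0$.
   Context: $g^{(r-1)}$ denotes the $(r-1)$-th derivative of $g$, with $g^{(0)}=g$. *)

theory Defs
  imports "HOL-Analysis.Analysis"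
begin

(* The formula is used on all reals; only its values on the open interval (-1,1) matter,
   since iterated derivatives are taken at points of (-1,1) only. *)
definition g :: "real \<Rightarrow> real" where
  "g a = pi / 4 * ((1 + tan (pi / 4 * a)) / (1 - tan (pi / 4 * a)))"

(* The summation index is shifted: the summand at n is the term of index n + 1. *)
definition Delta :: "nat \<Rightarrow> real" where
  "Delta r = (\<Sum>n. (-1) ^ n / real (n + 1) ^ r)"

end

theory Submission
  imports Defs
begin

text \<open>
  Split the left-hand side by the residue of \<open>l\<close> modulo \<open>q\<close>: with \<open>l = m q + j\<close>, the \<open>j\<close>-th part is
  \<open>q\<^sup>-\<^sup>r\<close> times the alternating series of \<open>(-1)\<^sup>m / (m + x)\<^sup>r\<close> at \<open>x = j / q\<close>. The residue
  \<open>j = q\<close> contributes the term with \<open>Delta r\<close>.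

  Both the remaining series and the derivatives of \<open>g\<close> are expressed by the polygamma function
  \<open>\<psi>\<close> of order \<open>n = r - 1\<close>. Pairing consecutive terms
  (\<open>alternating_sums_Polygamma\<close>) turns the series into a multiple of
  \<open>\<psi> ((x + 1) / 2) - \<psi> (x / 2)\<close>. Since \<open>g a\<close> is a multiple of the cotangent of
  \<open>pi (1 - a) / 4\<close>, the reflection formula for the digamma function writes \<open>g\<close> as a difference of two
  digamma values, which can be differentiated any number of times (\<open>higher_deriv_g\<close>); at
  \<open>a = 1 - 2 x\<close> this is a multiple of \<open>\<psi> (1 - x / 2) - \<psi> (x / 2)\<close>. The minus sign here survives
  the differentiation because \<open>n\<close> is even.

  The two differences need not agree for a single \<open>x\<close>, but the substitution \<open>k \<mapsto> q - k\<close>, that is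
  \<open>x \<mapsto> 1 - x\<close>, exchanges \<open>(x + 1) / 2\<close> and \<open>1 - x / 2\<close>, so that the sums over
  \<open>k = 1, \<dots>, q - 1\<close> agree.
\<close>

text \<open>
  For order \<open>0\<close> the two series diverge separately, and only their difference is summable; the
  logarithms in the limit formula for the digamma function cancel.
\<close>
lemma Polygamma_diff_sums:
  fixes z w :: "'a :: {real_normed_field, banach}"
  assumes "z \<noteq> 0" "w \<noteq> 0"
  shows "(\<lambda>k. inverse ((z + of_nat k) ^ Suc n) - inverse ((w + of_nat k) ^ Suc n)) sums
           ((-1) ^ n * (Polygamma n w - Polygamma n z) / fact n)"
proof (cases "n = 0")
  case True
  have "(\<lambda>m. (of_real (ln (real m)) - (\<Sum>k<m. inverse (w + of_nat k))) -
             (of_real (ln (real m)) - (\<Sum>k<m. inverse (z + of_nat k))))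
          \<longlonglongrightarrow> Digamma w - Digamma z"
    by (intro tendsto_diff Digamma_LIMSEQ assms)
  thus ?thesis
    using True by (simp add: sums_def sum_subtractf)
next
  case False
  hence "(\<lambda>k. inverse ((z + of_nat k) ^ Suc n) - inverse ((w + of_nat k) ^ Suc n)) sums
           ((-1) ^ Suc n * Polygamma n z / fact n - (-1) ^ Suc n * Polygamma n w / fact n)"
    by (intro sums_diff Polygamma_LIMSEQ assms) auto
  thus ?thesis
    by (simp add: field_simps)
qed

text \<open>
  Leibniz's criterion gives convergence, so the sum may be computed by pairing the terms
  \<open>2 k\<close> and \<open>2 k + 1\<close>, which are \<open>1 / (2 k + x)\<^sup>r\<close> and \<open>- 1 / (2 k + 1 + x)\<^sup>r\<close>; extracting
  \<open>2\<close> from both denominators leaves series with unit steps.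
\<close>
lemma alternating_sums_Polygamma:
  fixes x :: real
  assumes "x > 0"
  shows "(\<lambda>m. (-1) ^ m / (real m + x) ^ Suc n) sums
           ((-1) ^ n * (Polygamma n ((x + 1) / 2) - Polygamma n (x / 2)) / (2 ^ Suc n * fact n))"
    (is "?f sums ?S")
proof -
  let ?a = "\<lambda>m. inverse ((real m + x) ^ Suc n)"
  have "?a \<longlonglongrightarrow> 0"
    by (intro tendsto_inverse_0_at_top filterlim_pow_at_top filterlim_real_sequentially
          filterlim_tendsto_add_at_top[OF tendsto_const, of _ _ x, unfolded add.commute[of x]]) auto
  moreover have "monoseq ?a"
    using assms by (intro monoI2) (auto intro!: le_imp_inverse_le power_mono zero_less_power simp del: power_Suc)
  ultimately have "summable ?f"
    using summable_Leibniz(1)[of ?a] by (simp add: divide_inverse)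
  then obtain s where s: "?f sums s"
    by (auto simp: summable_def)
  from sums_group[OF this, of 2]
  have "(\<lambda>k. sum ?f {k * 2..<k * 2 + 2}) sums s"
    by simp
  moreover have "sum ?f {k * 2..<k * 2 + 2} =
      (inverse ((x / 2 + of_nat k) ^ Suc n) - inverse (((x + 1) / 2 + of_nat k) ^ Suc n))
        / 2 ^ Suc n" for k
  proof -
    have "{k * 2..<k * 2 + 2} = {2 * k, Suc (2 * k)}"
      by auto
    hence "sum ?f {k * 2..<k * 2 + 2} =
             1 / (2 * real k + x) ^ Suc n - 1 / (2 * real k + 1 + x) ^ Suc n"
      by (simp add: add_ac)
    also have "2 * real k + x = 2 * (x / 2 + real k)"
      by simp
    also have "2 * real k + 1 + x = 2 * ((x + 1) / 2 + real k)"
      by simp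
    finally show ?thesis
      by (simp only: power_mult_distrib divide_inverse inverse_mult_distrib) (simp add: algebra_simps)
  qed
  moreover have "(\<lambda>k. (inverse ((x / 2 + of_nat k) ^ Suc n) -
      inverse (((x + 1) / 2 + of_nat k) ^ Suc n)) / 2 ^ Suc n) sums
      ((-1) ^ n * (Polygamma n ((x + 1) / 2) - Polygamma n (x / 2)) / fact n / 2 ^ Suc n)"
    using assms by (intro sums_divide Polygamma_diff_sums) auto
  ultimately have "s = ?S"
    by (auto dest: sums_unique2 simp: mult_ac)
  with s show ?thesis
    by simp
qed

lemma Gamma_reflection_real:
  "Gamma x * Gamma (1 - x) = pi / sin (pi * x)" for x :: real
proof -
  have "complex_of_real (Gamma x * Gamma (1 - x)) = complex_of_real (pi / sin (pi * x))"
    using Gamma_reflection_complex[of "complex_of_real x"]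
    by (simp flip: Gamma_complex_of_real sin_of_real)
  thus ?thesis
    by (simp only: of_real_eq_iff)
qed

text \<open>This is the logarithmic derivative of the reflection formula for the Gamma function.\<close>
lemma Digamma_reflection_real:
  fixes x :: real
  assumes "0 < x" "x < 1"
  shows "Digamma (1 - x) - Digamma x = pi * cot (pi * x)"
proof -
  have s: "sin (pi * x) > 0"
    using assms by (intro sin_gt_zero) auto
  have nonpos: "x \<notin> \<int>\<^sub>\<le>\<^sub>0" "1 - x \<notin> \<int>\<^sub>\<le>\<^sub>0"
    using assms by (auto elim!: nonpos_Ints_cases)
  have "((\<lambda>x. Gamma x * Gamma (1 - x)) has_real_derivative
          Gamma x * Gamma (1 - x) * (Digamma x - Digamma (1 - x))) (at x)"
    using nonpos by (auto intro!: derivative_eq_intros simp: algebra_simps)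
  hence "((\<lambda>x. pi / sin (pi * x)) has_real_derivative
          pi / sin (pi * x) * (Digamma x - Digamma (1 - x))) (at x)"
    by (simp only: Gamma_reflection_real)
  moreover have "((\<lambda>x. pi / sin (pi * x)) has_real_derivative
          pi / sin (pi * x) * (- pi * cot (pi * x))) (at x)"
    using s by (auto intro!: derivative_eq_intros simp: cot_def field_simps)
  ultimately have "pi / sin (pi * x) * (Digamma x - Digamma (1 - x)) =
      pi / sin (pi * x) * (- pi * cot (pi * x))"
    by (rule DERIV_unique)
  with s have "Digamma x - Digamma (1 - x) = - pi * cot (pi * x)"
    by (subst (asm) mult_cancel_left) auto
  thus ?thesis
    by simp
qed

text \<open>
  By the addition theorem \<open>g a\<close> is \<open>pi / 4\<close> times the tangent of \<open>pi (1 + a) / 4\<close>, hence times the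
  cotangent of the complementary angle \<open>pi (1 - a) / 4\<close>.
\<close>
lemma g_eq_Digamma:
  assumes "-1 < a" "a < 1"
  shows "g a = (Digamma ((3 + a) / 4) - Digamma ((1 - a) / 4)) / 4"
proof -
  let ?t = "pi / 4 * a"
  have bound: "-(pi / 4) < ?t" "?t < pi / 4"
    using assms mult_strict_left_mono[of "-1" a "pi / 4"] mult_strict_left_mono[of a 1 "pi / 4"]
    by auto
  have "cos ?t > 0"
    using bound pi_gt_zero by (intro cos_gt_zero_pi) linarith+
  have "cos (pi / 4 - ?t) = sqrt 2 / 2 * (cos ?t + sin ?t)"
       "sin (pi / 4 - ?t) = sqrt 2 / 2 * (cos ?t - sin ?t)"
    by (simp_all only: sin_diff cos_diff sin_45 cos_45 distrib_left right_diff_distrib)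
  hence "cot (pi / 4 - ?t) = (cos ?t + sin ?t) / (cos ?t - sin ?t)"
    unfolding cot_def by (simp only: mult_divide_mult_cancel_left) simp
  also have "\<dots> = (1 + tan ?t) / (1 - tan ?t)"
    using \<open>cos ?t > 0\<close> by (simp add: tan_def divide_simps)
  also have "pi / 4 - ?t = pi * ((1 - a) / 4)"
    by (simp add: field_simps)
  finally have "g a = pi * cot (pi * ((1 - a) / 4)) / 4"
    by (simp only: g_def times_divide_eq_left)
  also have "pi * cot (pi * ((1 - a) / 4)) = Digamma (1 - (1 - a) / 4) - Digamma ((1 - a) / 4)"
    using assms by (intro Digamma_reflection_real[symmetric]) auto
  also have "1 - (1 - a) / 4 = (3 + a) / 4"
    by (simp add: field_simps)
  finally show ?thesis .
qed

lemma higher_deriv_g: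
  assumes "-1 < a" "a < 1"
  shows "(deriv ^^ n) g a =
    (Polygamma n ((3 + a) / 4) - (-1) ^ n * Polygamma n ((1 - a) / 4)) / 4 ^ Suc n"
  using assms
proof (induction n arbitrary: a)
  case 0
  thus ?case
    by (simp add: g_eq_Digamma)
next
  case (Suc n)
  let ?h = "\<lambda>a. (Polygamma n ((3 + a) / 4) - (-1) ^ n * Polygamma n ((1 - a) / 4)) / 4 ^ Suc n"
  have "eventually (\<lambda>b. b \<in> {-1<..<1}) (nhds a)"
    using Suc.prems by (intro eventually_nhds_in_open) auto
  hence "eventually (\<lambda>b. (deriv ^^ n) g b = ?h b) (nhds a)"
    by eventually_elim (use Suc.IH in auto)
  hence deriv_eq: "(deriv ^^ Suc n) g a = deriv ?h a"
    by (auto intro!: deriv_cong_ev)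
  have "(3 + a) / 4 \<notin> \<int>\<^sub>\<le>\<^sub>0" "(1 - a) / 4 \<notin> \<int>\<^sub>\<le>\<^sub>0"
    using Suc.prems by (auto dest!: nonpos_Ints_nonpos)
  hence "(?h has_real_derivative
      (Polygamma (Suc n) ((3 + a) / 4) - (-1) ^ Suc n * Polygamma (Suc n) ((1 - a) / 4))
        / 4 ^ Suc (Suc n)) (at a)"
    by (auto intro!: derivative_eq_intros simp: field_simps)
  hence "deriv ?h a = (Polygamma (Suc n) ((3 + a) / 4) -
      (-1) ^ Suc n * Polygamma (Suc n) ((1 - a) / 4)) / 4 ^ Suc (Suc n)"
    by (rule DERIV_imp_deriv)
  with deriv_eq show ?case
    by simp
qed

theorem mainTheorem8:
  fixes r q :: nat
  assumes "odd r" and "q > 0"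
  shows "(\<lambda>m. (-1) ^ m * (\<Sum>l = m * q + 1..(m + 1) * q. 1 / real l ^ r)) sums
    (Delta r / real q ^ r
      + 2 ^ r / (fact (r - 1) * real q ^ r)
        * (\<Sum>k = 1..q - 1. (deriv ^^ (r - 1)) g ((real q - 2 * real k) / real q)))"
proof -
  from \<open>odd r\<close> obtain n where r: "r = Suc n" and "even n"
    by (cases r) auto
  let ?x = "\<lambda>j. real j / real q"
  define A where "A = (\<lambda>x. \<Sum>m. (-1) ^ m / (real m + x) ^ r)"
  have A: "(\<lambda>m. (-1) ^ m / (real m + x) ^ r) sums A x"
    and A_eq: "A x = (Polygamma n ((x + 1) / 2) - Polygamma n (x / 2)) / (2 ^ r * fact n)"
    if "x > 0" for x
    using alternating_sums_Polygamma[OF that, of n] \<open>even n\<close> by (auto simp: A_def r sums_iff)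

  have lhs: "(-1) ^ m * (\<Sum>l = m * q + 1..(m + 1) * q. 1 / real l ^ r) =
      (\<Sum>j = 1..q. (-1) ^ m / (real m + ?x j) ^ r / real q ^ r)" for m
  proof -
    have "(\<Sum>l = m * q + 1..(m + 1) * q. 1 / real l ^ r) =
            (\<Sum>j = 1..q. 1 / real (j + m * q) ^ r)"
      using sum.shift_bounds_cl_nat_ivl[of "\<lambda>l. 1 / real l ^ r" 1 "m * q" q]
      by (simp add: add_ac)
    also have "\<dots> = (\<Sum>j = 1..q. 1 / ((real m + ?x j) * real q) ^ r)"
      using \<open>q > 0\<close> by (simp add: distrib_right add.commute)
    finally show ?thesis
      by (simp add: sum_distrib_left power_mult_distrib)
  qed
  have "(\<lambda>m. (-1) ^ m * (\<Sum>l = m * q + 1..(m + 1) * q. 1 / real l ^ r)) sums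
          (\<Sum>j = 1..q. A (?x j) / real q ^ r)"
    unfolding lhs using \<open>q > 0\<close> by (intro sums_sum sums_divide A) auto

  also have "(\<Sum>j = 1..q. A (?x j) / real q ^ r) =
      A 1 / real q ^ r + (\<Sum>j = 1..q - 1. A (?x j)) / real q ^ r"
    using \<open>q > 0\<close> by (cases q) (simp_all add: sum_divide_distrib)
  also have "A 1 = Delta r"
    by (simp add: A_def Delta_def add_ac)

  also have "(\<Sum>j = 1..q - 1. A (?x j)) =
      ((\<Sum>j = 1..q - 1. Polygamma n ((?x j + 1) / 2)) - (\<Sum>j = 1..q - 1. Polygamma n (?x j / 2)))
        / (2 ^ r * fact n)"
    using \<open>q > 0\<close> by (simp add: A_eq sum_divide_distrib sum_subtractf diff_divide_distrib)
  also have "(\<Sum>j = 1..q - 1. Polygamma n ((?x j + 1) / 2)) =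
      (\<Sum>k = 1..q - 1. Polygamma n (1 - ?x k / 2))"
    using \<open>q > 0\<close>
    by (intro sum.reindex_bij_witness[of _ "\<lambda>k. q - k" "\<lambda>k. q - k"])
       (auto simp: of_nat_diff field_simps intro!: arg_cong[of _ _ "Polygamma n"])
  also have "\<dots> - (\<Sum>k = 1..q - 1. Polygamma n (?x k / 2)) =
      4 ^ r * (\<Sum>k = 1..q - 1. (deriv ^^ n) g ((real q - 2 * real k) / real q))"
  proof -
    have "(deriv ^^ n) g ((real q - 2 * real k) / real q) =
        (Polygamma n (1 - ?x k / 2) - Polygamma n (?x k / 2)) / 4 ^ r"
      if "k \<in> {1..q - 1}" for k
    proof -
      let ?a = "(real q - 2 * real k) / real q"
      have "k < q" "0 < k"
        using that \<open>q > 0\<close> by auto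
      hence "-1 < ?a" "?a < 1"
        by (simp_all add: field_simps)
      hence "(deriv ^^ n) g ?a =
          (Polygamma n ((3 + ?a) / 4) - (-1) ^ n * Polygamma n ((1 - ?a) / 4)) / 4 ^ r"
        unfolding r by (rule higher_deriv_g)
      moreover have "(3 + ?a) / 4 = 1 - ?x k / 2" "(1 - ?a) / 4 = ?x k / 2"
        using \<open>q > 0\<close> by (simp_all add: field_simps)
      ultimately show ?thesis
        using \<open>even n\<close> by (simp only: power_minus_even power_one mult_1)
    qed
    thus ?thesis
      by (simp add: sum_subtractf flip: sum_divide_distrib)
  qed
  also have "(4 :: real) ^ r = 2 ^ r * 2 ^ r"
    by (simp flip: power_mult_distrib)
  finally show ?thesis
    by (simp add: r mult.assoc)
qed

end
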